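(* Let $\alpha=(\alpha_n)_{n\ge1}$ be a strictly increasing, positive, finitely nuclear sequence which is stable. Then $\Delta(\mathcal{K}_{\alpha})=\Delta(\Lambda_{1}(\alpha))$ and $\delta(\mathcal{K}_{\alpha})=\delta(\Lambda_{1}(\alpha))$.
   Context: **Power series spaces of finite type.** For a non-negative increasing sequence $\alpha=(\alpha_n)_{n\ge1}$ with $\alpha_n\to+\infty$, $\Lambda_1(\alpha)=\{x=(x_n)_{n\ge1}:\|x\|_k=\sum_n|x_n|e^{-\alpha_n/k}<\infty\ \forall k\ge1\}$. The sequence $\alpha$ is finitely nuclear if $\Lambda_1(\alpha)$ is nuclear, equivalently $\lim_n\ln(n)/\alpha_n=0$. It is stable if $\sup_n\alpha_{2n}/\alpha_n<+\infty$. **The space $\mathcal K_\alpha$.** For $s\in\{1,2,\dots\}$ let $I_s=\{\frac{s(s+1)}2+ys+\frac{y(y-1)}2:\ y=0,1,2,\dots\}$. The sets $I_s$ are infinite, pairwise disjoint, and their union is $\{1,2,3,\dots\}$. For $k,n\ge1$ with $n\in I_s$ put $$a_{k,n}=\begin{cases}e^{-\frac1k\alpha_n},&k\le s,\\ e^{(-\frac1k+1)\alpha_n},&k\ge s+1.\end{cases}$$ Then $\mathcal K_\alpha=\{x=(x_n)_{n\ge1}:\|x\|_k=\sum_n|x_n|a_{k,n}<\infty\ \forall k\ge1\}$, a Fréchet space with the seminorms $\|\cdot\|_k$. **Diameters.** For absolutely convex sets $U,V$ in a Fréchet space $E$ with $V\subseteq CU$ for some $C>0$, the $n$-th Kolmogorov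 diameter ($n=0,1,2,\dots$) is $d_n(V,U)=\inf\{t>0:\ V\subseteq tU+L \text{ for some linear subspace } L\subseteq E,\ \dim L\le n\}$. **Diametral and approximate diametral dimension.** For a Fréchet space $E$ with increasing fundamental seminorms $\|\cdot\|_k$ and $U_k=\{x:\|x\|_k\le1\}$, $$\Delta(E)=\{(t_n)_{n\ge0}:\forall p\ \exists q>p\ \lim_n t_nd_n(U_q,U_p)=0\},$$ $$\delta(E)=\{(t_n)_{n\ge0}:\exists\, U\ \exists\, B\ \lim_n t_n/d_n(B,U)=0\}=\{(t_n)_{n\ge0}:\exists p\ \forall q>p\ \lim_n t_n/d_n(U_q,U_p)=0\},$$ where $U$ ranges over zero neighbourhoods and $B$ over bounded sets (the last equality is known for Fréchet spaces). *)

theory Defs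
  imports "HOL-Analysis.Analysis" "HOL-Library.Function_Algebras"
begin

text \<open>
  The scalar field is an arbitrary real normed field, i.e. (by Gelfand--Mazur) the real or the
  complex numbers. A Frechet space is given by its set of vectors together with an increasing
  fundamental system of seminorms \<open>seminorm E k\<close>, indexed by \<open>k \<ge> 1\<close>; the value at \<open>k = 0\<close> is never
  used.
\<close>

record 'v graded_space =
  vectors :: "'v set"
  seminorm :: "nat \<Rightarrow> 'v \<Rightarrow> real"

definition unit_ball :: "'v graded_space \<Rightarrow> nat \<Rightarrow> 'v set" where
  "unit_ball E k = {x \<in> vectors E. seminorm E k x \<le> 1}"

definition zero_neighbourhood :: "('v::zero) graded_space \<Rightarrow> 'v set \<Rightarrow> bool" where
  "zero_neighbourhood E U \<longleftrightarrow>
     U \<subseteq> vectors E \<and> (\<exists>k\<ge>1. \<exists>\<epsilon>>0. {x \<in> vectors E. seminorm E k x < \<epsilon>} \<subseteq> U)"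

definition bounded_subset :: "'v graded_space \<Rightarrow> 'v set \<Rightarrow> bool" where
  "bounded_subset E B \<longleftrightarrow>
     B \<subseteq> vectors E \<and> (\<forall>k\<ge>1. \<exists>C. \<forall>x\<in>B. seminorm E k x \<le> C)"

locale scalar_space = vector_space scale
  for scale :: "'k::real_normed_field \<Rightarrow> 'v::ab_group_add \<Rightarrow> 'v" (infixr "\<cdot>" 75)
begin

definition absolutely_convex :: "'v set \<Rightarrow> bool" where
  "absolutely_convex U \<longleftrightarrow>
     (\<forall>x\<in>U. \<forall>y\<in>U. \<forall>a b. norm a + norm b \<le> 1 \<longrightarrow> a \<cdot> x + b \<cdot> y \<in> U)"

text \<open>
  The library function \<open>dim\<close> is 0 on infinite-dimensional subspaces, so \<open>dim L \<le> n\<close> is expressed by a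
  spanning set of at most \<open>n\<close> elements. The infimum is the intended one only if \<open>V\<close> is absorbed by
  \<open>U\<close>, which is the case in all uses below.
\<close>

definition diameter ::
  "'v graded_space \<Rightarrow> 'v set \<Rightarrow> 'v set \<Rightarrow> nat \<Rightarrow> real" where
  "diameter E V U n =
     Inf {t. t > 0 \<and>
       (\<exists>L. subspace L \<and> L \<subseteq> vectors E \<and> (\<exists>S. finite S \<and> card S \<le> n \<and> span S = L) \<and>
            V \<subseteq> {of_real t \<cdot> u + l |u l. u \<in> U \<and> l \<in> L})}"

definition diametral_dimension :: "'v graded_space \<Rightarrow> (nat \<Rightarrow> 'k) set" where
  "diametral_dimension E =
     {t. \<forall>p\<ge>1. \<exists>q>p.
        (\<lambda>n. t n * of_real (diameter E (unit_ball E q) (unit_ball E p) n)) \<longlonglongrightarrow> 0}"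

text \<open>
  The quotient is taken in \<^typ>\<open>ennreal\<close>, so that \<open>t n / 0 = \<infinity>\<close> for \<open>t n \<noteq> 0\<close> (and \<open>0 / 0 = 0\<close>); with real
  division by zero, finite-dimensional \<open>B\<close> would put every sequence into the set. Diameters are
  only defined for absolutely convex sets, hence the restriction on \<open>U\<close> and \<open>B\<close>; it does not change
  the set, as every zero neighbourhood contains an absolutely convex one and absolutely convex hulls of
  bounded sets are bounded.
\<close>

definition approximate_diametral_dimension :: "'v graded_space \<Rightarrow> (nat \<Rightarrow> 'k) set" where
  "approximate_diametral_dimension E =
     {t. \<exists>U B. zero_neighbourhood E U \<and> absolutely_convex U \<and>
               bounded_subset E B \<and> absolutely_convex B \<and>
               (\<lambda>n. ennreal (norm (t n)) / ennreal (diameter E B U n)) \<longlonglongrightarrow> 0}"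

definition linear_functional_on :: "'v set \<Rightarrow> ('v \<Rightarrow> 'k) \<Rightarrow> bool" where
  "linear_functional_on V f \<longleftrightarrow>
     (\<forall>x\<in>V. \<forall>y\<in>V. f (x + y) = f x + f y) \<and> (\<forall>x\<in>V. \<forall>c. f (c \<cdot> x) = c * f x)"

text \<open>
  Grothendieck's definition: for every \<open>p\<close> there is \<open>q > p\<close> such that the canonical map \<open>E\<^sub>q \<rightarrow> E\<^sub>p\<close>
  between the local Banach spaces (the completions of \<open>E\<close> modulo the kernels of the seminorms) is
  nuclear, i.e. equal to \<open>\<Sum>j. f j \<otimes> y j\<close> with \<open>\<Sum>j. \<parallel>f j\<parallel> \<parallel>y j\<parallel> < \<infinity>\<close>. Functionals on \<open>E\<^sub>q\<close> are the same as
  functionals on \<open>E\<close> bounded by a multiple \<open>c j\<close> of the \<open>q\<close>-th seminorm; the \<open>y j\<close> may be taken from \<open>E\<close>,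
  since every element of \<open>E\<^sub>p\<close> is an absolutely convergent sum of classes of elements of \<open>E\<close>.
\<close>

definition nuclear :: "'v graded_space \<Rightarrow> bool" where
  "nuclear E \<longleftrightarrow>
     (\<forall>p\<ge>1. \<exists>q>p. \<exists>(f :: nat \<Rightarrow> 'v \<Rightarrow> 'k) (c :: nat \<Rightarrow> real) (y :: nat \<Rightarrow> 'v).
        (\<forall>j. linear_functional_on (vectors E) (f j) \<and>
             (\<forall>x\<in>vectors E. norm (f j x) \<le> c j * seminorm E q x)) \<and>
        (\<forall>j. 0 \<le> c j \<and> y j \<in> vectors E) \<and>
        summable (\<lambda>j. c j * seminorm E p (y j)) \<and>
        (\<forall>x\<in>vectors E. (\<lambda>m. seminorm E p (x - (\<Sum>j<m. f j x \<cdot> y j))) \<longlonglongrightarrow> 0))"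

end

text \<open>
  Sequences indexed by \<open>n \<ge> 1\<close> are functions on \<^typ>\<open>nat\<close>. Members of sequence spaces vanish at the
  unused index 0; exponent sequences and weights are arbitrary there.
\<close>

definition seq_scale :: "'k::real_normed_field \<Rightarrow> (nat \<Rightarrow> 'k) \<Rightarrow> nat \<Rightarrow> 'k" where
  "seq_scale c x = (\<lambda>n. c * x n)"

interpretation seq: scalar_space "seq_scale :: 'k::real_normed_field \<Rightarrow> (nat \<Rightarrow> 'k) \<Rightarrow> nat \<Rightarrow> 'k"
  by unfold_locales (auto simp: seq_scale_def plus_fun_def algebra_simps)

definition koethe_space :: "(nat \<Rightarrow> nat \<Rightarrow> real) \<Rightarrow> (nat \<Rightarrow> 'k::real_normed_field) graded_space" where
  "koethe_space a =
     \<lparr>vectors = {x. x 0 = 0 \<and> (\<forall>k\<ge>1. summable (\<lambda>n. norm (x n) * a k n))},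
      seminorm = (\<lambda>k x. \<Sum>n. norm (x n) * a k n)\<rparr>"

definition power_series_space :: "(nat \<Rightarrow> real) \<Rightarrow> (nat \<Rightarrow> 'k::real_normed_field) graded_space" where
  "power_series_space \<alpha> = koethe_space (\<lambda>k n. exp (- \<alpha> n / real k))"

definition finitely_nuclear :: "'k::real_normed_field itself \<Rightarrow> (nat \<Rightarrow> real) \<Rightarrow> bool" where
  "finitely_nuclear _ \<alpha> \<longleftrightarrow>
     seq.nuclear (power_series_space \<alpha> :: (nat \<Rightarrow> 'k) graded_space)"

lemma finitely_nuclear_iff:
  fixes \<alpha> :: "nat \<Rightarrow> real"
  assumes pos: "\<And>n. n \<ge> 1 \<Longrightarrow> \<alpha> n > 0" and mono: "mono_on {1..} \<alpha>"
    and lim: "filterlim \<alpha> at_top sequentially"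
  shows "finitely_nuclear TYPE('k::real_normed_field) \<alpha> \<longleftrightarrow> (\<lambda>n. ln (real n) / \<alpha> n) \<longlonglongrightarrow> 0"
proof -
  define E :: "(nat \<Rightarrow> 'k) graded_space" where "E = power_series_space \<alpha>"
  define e :: "nat \<Rightarrow> nat \<Rightarrow> 'k" where "e j = (\<lambda>n. if n = j then 1 else 0)" for j
  define a where "a k n = exp (- \<alpha> n / real k)" for k n
  have a_pos: "a k n > 0" for k n by (simp add: a_def)
  have vec: "x \<in> vectors E \<longleftrightarrow> x 0 = 0 \<and> (\<forall>k\<ge>1. summable (\<lambda>n. norm (x n) * a k n))" for x
    by (simp add: E_def power_series_space_def koethe_space_def a_def)
  have semi: "seminorm E k x = (\<Sum>n. norm (x n) * a k n)" for k x
    by (simp add: E_def power_series_space_def koethe_space_def a_def)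
  have e_sums: "(\<lambda>n. norm (e j n) * a k n) sums a k j" for j k
  proof -
    have "(\<lambda>n. norm (e j n) * a k n) = (\<lambda>n. if n = j then a k n else 0)" by (auto simp: e_def)
    then show ?thesis using sums_single[of j "a k"] by simp
  qed
  have e_vec: "e j \<in> vectors E" if "j \<ge> 1" for j
  proof -
    have "e j 0 = 0" using that by (simp add: e_def)
    then show ?thesis using e_sums[of j] by (auto simp: vec sums_iff)
  qed
  have e_semi: "seminorm E k (e j) = a k j" for k j
    using e_sums by (simp add: semi sums_iff)
  have coord: "norm (x n) * a k n \<le> seminorm E k x" "summable (\<lambda>n. norm (x n) * a k n)"
    if "x \<in> vectors E" "k \<ge> 1" for x n k
  proof -
    show *: "summable (\<lambda>n. norm (x n) * a k n)" using that by (simp add: vec)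
    show "norm (x n) * a k n \<le> seminorm E k x"
      using sum_le_suminf[OF *, of "{n}"] a_pos by (simp add: semi less_imp_le)
  qed
  have sum_fun_apply: "(\<Sum>j\<in>A. g j) n = (\<Sum>j\<in>A. g j n)" for g :: "nat \<Rightarrow> nat \<Rightarrow> 'k" and A n
    by (induction A rule: infinite_finite_induct) auto
  show ?thesis
  proof
    assume R: "(\<lambda>n. ln (real n) / \<alpha> n) \<longlonglongrightarrow> 0"
    show "finitely_nuclear TYPE('k) \<alpha>"
      unfolding finitely_nuclear_def E_def[symmetric] seq.nuclear_def
    proof (intro allI impI)
      fix p :: nat assume p: "p \<ge> 1"
      define q where "q = Suc p"
      define d where "d = 1 / real p - 1 / real q"
      have d: "d > 0" unfolding d_def q_def using p by (simp add: frac_less2)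
      define y :: "nat \<Rightarrow> nat \<Rightarrow> 'k" where "y j = (if j = 0 then 0 else e j)" for j
      have y_semi: "seminorm E p (y j) \<le> a p j" "seminorm E p (y j) \<ge> 0" for j
        using a_pos[of p j] e_semi by (auto simp: y_def) (auto simp: semi)
      have y_vec: "y j \<in> vectors E" for j
        using e_vec by (auto simp: y_def) (auto simp: vec)
      have "eventually (\<lambda>n. ln (real n) / \<alpha> n < d / 2) sequentially"
        using R d by (intro order_tendstoD(2)[OF R]) auto
      then have ev: "eventually (\<lambda>n. norm (1 / a q n * seminorm E p (y n)) \<le> 1 / real n ^ 2) sequentially"
        using eventually_ge_at_top[of 1]
      proof eventually_elim
        case (elim n)
        then have "2 * ln (real n) \<le> d * \<alpha> n" using pos[of n] by (simp add: field_simps)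
        then have "exp (- (d * \<alpha> n)) \<le> exp (- (2 * ln (real n)))" by simp
        also have "\<dots> = 1 / real n ^ 2"
          using elim by (simp add: exp_minus exp_double inverse_eq_divide)
        finally have *: "exp (- (d * \<alpha> n)) \<le> 1 / real n ^ 2" .
        have "1 / a q n * seminorm E p (y n) \<le> 1 / a q n * a p n"
          using y_semi a_pos[of q n] by (intro mult_left_mono) auto
        also have "\<dots> = exp (- (d * \<alpha> n))"
          by (simp add: a_def d_def exp_diff[symmetric] algebra_simps)
        finally show ?case using * y_semi(2)[of n] a_pos[of q n] by simp
      qed
      have summ: "summable (\<lambda>n. 1 / a q n * seminorm E p (y n))"
        by (rule summable_comparison_test_ev[OF ev])
           (use inverse_power_summable[of 2, where ?'a = real] in \<open>simp add: inverse_eq_divide\<close>)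
      have conv: "(\<lambda>m. seminorm E p (x - (\<Sum>j<m. seq_scale (x j) (y j)))) \<longlonglongrightarrow> 0" if x: "x \<in> vectors E" for x
      proof -
        have tail: "(x - (\<Sum>j<m. seq_scale (x j) (y j))) n = (if n < m then 0 else x n)" for m n
        proof -
          have "(\<Sum>j<m. seq_scale (x j) (y j)) n = (\<Sum>j<m. if j = n then x n else 0)"
            unfolding sum_fun_apply using x
            by (intro sum.cong) (auto simp: seq_scale_def y_def e_def vec)
          then show ?thesis by simp
        qed
        let ?s = "\<lambda>n. norm (x n) * a p n"
        have s: "summable ?s" using coord(2)[OF x p] .
        have "seminorm E p (x - (\<Sum>j<m. seq_scale (x j) (y j))) = (\<Sum>n. ?s n) - (\<Sum>n<m. ?s n)" for m
        proof -
          have "(\<lambda>n. if n < m then ?s n else 0) sums (\<Sum>n<m. ?s n)"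
            using sums_If_finite_set[of "{..<m}" ?s] by simp
          from sums_diff[OF summable_sums[OF s] this]
          have "(\<lambda>n. ?s n - (if n < m then ?s n else 0)) sums ((\<Sum>n. ?s n) - (\<Sum>n<m. ?s n))" .
          moreover have "(\<lambda>n. ?s n - (if n < m then ?s n else 0)) = (\<lambda>n. norm (if n < m then 0 else x n) * a p n)"
            by auto
          ultimately show ?thesis unfolding semi tail by (simp add: sums_iff)
        qed
        moreover have "(\<lambda>m. (\<Sum>n. ?s n) - (\<Sum>n<m. ?s n)) \<longlonglongrightarrow> (\<Sum>n. ?s n) - (\<Sum>n. ?s n)"
          by (intro tendsto_diff tendsto_const summable_LIMSEQ s)
        ultimately show ?thesis by simp
      qed
      have bnd: "norm (x j) \<le> 1 / a q j * seminorm E q x" if "x \<in> vectors E" for x j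
        using coord(1)[OF that, of q j] a_pos[of q j] by (simp add: q_def field_simps)
      show "\<exists>q>p. \<exists>f c y. (\<forall>j. seq.linear_functional_on (vectors E) (f j) \<and>
             (\<forall>x\<in>vectors E. norm (f j x) \<le> c j * seminorm E q x)) \<and>
             (\<forall>j. 0 \<le> c j \<and> y j \<in> vectors E) \<and> summable (\<lambda>j. c j * seminorm E p (y j)) \<and>
             (\<forall>x\<in>vectors E. (\<lambda>m. seminorm E p (x - (\<Sum>j<m. seq_scale (f j x) (y j)))) \<longlonglongrightarrow> 0)"
        by (rule exI[of _ q], rule conjI, simp add: q_def, rule exI[of _ "\<lambda>j x. x j"],
            rule exI[of _ "\<lambda>j. 1 / a q j"], rule exI[of _ y])
           (use summ conv bnd y_vec a_pos in
             \<open>auto simp: seq.linear_functional_on_def seq_scale_def less_imp_le\<close>)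
    qed
  next
    assume "finitely_nuclear TYPE('k) \<alpha>"
    then have nuc: "seq.nuclear E" by (simp add: finitely_nuclear_def E_def)
    have bound: "\<exists>S>0. \<forall>N\<ge>1. ln (real N) \<le> ln S + \<alpha> N / real p" if p: "p \<ge> 1" for p
    proof -
      obtain q f c y where q: "q > p" and H:
          "(\<forall>j. seq.linear_functional_on (vectors E) (f j) \<and>
              (\<forall>x\<in>vectors E. norm (f j x) \<le> c j * seminorm E q x)) \<and>
           (\<forall>j. 0 \<le> c j \<and> y j \<in> vectors E) \<and> summable (\<lambda>j. c j * seminorm E p (y j)) \<and>
           (\<forall>x\<in>vectors E. (\<lambda>m. seminorm E p (x - (\<Sum>j<m. seq_scale (f j x) (y j)))) \<longlonglongrightarrow> 0)"
        using nuc[unfolded seq.nuclear_def, rule_format, OF p] by (elim exE conjE) (rule that, assumption, (intro conjI; assumption))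
      from H have f: "\<And>j x. x \<in> vectors E \<Longrightarrow> norm (f j x) \<le> c j * seminorm E q x"
        and c: "\<And>j. 0 \<le> c j" and y: "\<And>j. y j \<in> vectors E"
        and summ: "summable (\<lambda>j. c j * seminorm E p (y j))"
        and conv: "\<And>x. x \<in> vectors E \<Longrightarrow>
            (\<lambda>m. seminorm E p (x - (\<Sum>j<m. seq_scale (f j x) (y j)))) \<longlonglongrightarrow> 0"
        by auto
      define S where "S = (\<Sum>j. c j * seminorm E p (y j)) + 1"
      have y_semi: "seminorm E p (y j) \<ge> 0" for j
        using coord(1)[OF y p, of j 0] a_pos[of p 0] by (smt (verit) mult_nonneg_nonneg norm_ge_zero)
      have S: "S > 0" unfolding S_def using suminf_nonneg[OF summ] c y_semi by (simp add: add_nonneg_pos)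
      have scal: "seq_scale r x \<in> vectors E" if "x \<in> vectors E" for r x
        using that by (auto simp: vec seq_scale_def norm_mult mult.assoc intro!: summable_mult)
      have add: "x + x' \<in> vectors E" if "x \<in> vectors E" "x' \<in> vectors E" for x x'
        unfolding vec
      proof (intro conjI allI impI)
        show "(x + x') 0 = 0" using that by (simp add: vec)
        fix k :: nat assume k: "k \<ge> 1"
        show "summable (\<lambda>n. norm ((x + x') n) * a k n)"
        proof (rule summable_comparison_test')
          show "summable (\<lambda>n. norm (x n) * a k n + norm (x' n) * a k n)"
            using that k by (intro summable_add coord(2))
          show "norm (norm ((x + x') n) * a k n) \<le> norm (x n) * a k n + norm (x' n) * a k n" for n
            using norm_triangle_ineq[of "x n" "x' n"] a_pos[of k n]
            by (simp add: distrib_right[symmetric])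
        qed
      qed
      have zero: "0 \<in> vectors E" by (simp add: vec)
      have sumv: "(\<Sum>j<m. seq_scale (f j x) (y j)) \<in> vectors E" for m x
        by (induction m) (simp_all only: lessThan_0 sum.empty zero sum.lessThan_Suc add scal[OF y])
      have diffv: "x - (\<Sum>j<m. seq_scale (f j x) (y j)) \<in> vectors E" if "x \<in> vectors E" for m x
        using add[OF that scal[OF sumv, of "-1"]] by (simp add: seq_scale_def fun_diff_def plus_fun_def)
      have coordlim: "(\<lambda>j. f j (e n) * y j n) sums 1" if n: "n \<ge> 1" for n
      proof -
        have "(\<lambda>m. 1 - (\<Sum>j<m. f j (e n) * y j n)) \<longlonglongrightarrow> 0"
        proof (rule Lim_null_comparison)
          show "\<forall>\<^sub>F m in sequentially. norm (1 - (\<Sum>j<m. f j (e n) * y j n))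
                  \<le> seminorm E p (e n - (\<Sum>j<m. seq_scale (f j (e n)) (y j))) / a p n"
          proof (rule always_eventually, rule allI)
            fix m
            show "norm (1 - (\<Sum>j<m. f j (e n) * y j n))
                  \<le> seminorm E p (e n - (\<Sum>j<m. seq_scale (f j (e n)) (y j))) / a p n"
              using coord(1)[OF diffv[OF e_vec[OF n], of m] p, of n] a_pos[of p n]
              by (simp add: sum_fun_apply seq_scale_def e_def pos_le_divide_eq)
          qed
          show "(\<lambda>m. seminorm E p (e n - (\<Sum>j<m. seq_scale (f j (e n)) (y j))) / a p n) \<longlonglongrightarrow> 0"
            using tendsto_divide[OF conv[OF e_vec[OF n]] tendsto_const, of "a p n"] a_pos[of p n] by simp
        qed
        from tendsto_diff[OF tendsto_const this, of 1]
        show ?thesis unfolding sums_def by simp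
      qed
      have summn: "summable (\<lambda>j. c j * (norm (y j n) * a p n))" for n
        using coord(1)[OF y p] c a_pos[of p n]
        by (intro summable_comparison_test'[OF summ]) (auto intro!: mult_left_mono simp: abs_mult)
      have ratio: "a p n / a q n \<le> (\<Sum>j. c j * (norm (y j n) * a p n))" if n: "n \<ge> 1" for n
      proof -
        have le: "norm (f j (e n) * y j n) \<le> c j * (norm (y j n) * a p n) * (a q n / a p n)" for j
          using mult_right_mono[OF f[OF e_vec[OF n], of j] norm_ge_zero[of "y j n"]] a_pos[of p n]
          by (simp add: norm_mult e_semi mult_ac)
        have "norm (1::'k) \<le> (\<Sum>j. c j * (norm (y j n) * a p n) * (a q n / a p n))"
        proof (rule LIMSEQ_le)
          show "(\<lambda>m. norm (\<Sum>j<m. f j (e n) * y j n)) \<longlonglongrightarrow> norm (1::'k)"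
            using coordlim[OF n] unfolding sums_def by (rule tendsto_norm)
          show "(\<lambda>m. \<Sum>j<m. c j * (norm (y j n) * a p n) * (a q n / a p n))
                  \<longlonglongrightarrow> (\<Sum>j. c j * (norm (y j n) * a p n) * (a q n / a p n))"
            by (intro summable_LIMSEQ summable_mult2 summn)
        qed (use le in \<open>auto intro!: sum_norm_le\<close>)
        also have "\<dots> = (\<Sum>j. c j * (norm (y j n) * a p n)) * (a q n / a p n)"
          by (rule suminf_mult2[OF summn, symmetric])
        finally have "1 \<le> (\<Sum>j. c j * (norm (y j n) * a p n)) * (a q n / a p n)" by simp
        then show ?thesis using a_pos[of p n] a_pos[of q n] by (simp add: field_simps)
      qed
      have "ln (real N) \<le> ln S + \<alpha> N / real p" if N: "N \<ge> 1" for N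
      proof -
        have "real N * (a p N / a q N) = (\<Sum>n\<in>{1..N}. a p N / a q N)" by simp
        also have "\<dots> \<le> (\<Sum>n\<in>{1..N}. a p n / a q n)"
        proof (rule sum_mono)
          fix n assume n: "n \<in> {1..N}"
          then have "\<alpha> n \<le> \<alpha> N" using mono by (auto intro: mono_onD)
          moreover have "1 / real p - 1 / real q \<ge> 0" using p q by (simp add: field_simps)
          ultimately have "(1 / real p - 1 / real q) * \<alpha> n \<le> (1 / real p - 1 / real q) * \<alpha> N"
            by (rule mult_left_mono)
          then show "a p N / a q N \<le> a p n / a q n"
            by (simp add: a_def exp_diff[symmetric] algebra_simps)
        qed
        also have "\<dots> \<le> (\<Sum>n\<in>{1..N}. \<Sum>j. c j * (norm (y j n) * a p n))"
          by (intro sum_mono ratio) auto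
        also have "\<dots> = (\<Sum>j. \<Sum>n\<in>{1..N}. c j * (norm (y j n) * a p n))"
          by (rule suminf_sum[symmetric]) (rule summn)
        also have "\<dots> \<le> (\<Sum>j. c j * seminorm E p (y j))"
        proof (rule suminf_le)
          show "(\<Sum>n\<in>{1..N}. c j * (norm (y j n) * a p n)) \<le> c j * seminorm E p (y j)" for j
            unfolding sum_distrib_left[symmetric] semi using a_pos c
            by (intro mult_left_mono sum_le_suminf coord(2)[OF y p]) (auto simp: less_imp_le)
        qed (auto intro: summable_sum summn summ)
        also have "\<dots> \<le> S" by (simp add: S_def)
        finally have "ln (real N * (a p N / a q N)) \<le> ln S"
          using N S a_pos[of p N] a_pos[of q N] by (subst ln_le_cancel_iff) auto
        moreover have "ln (real N * (a p N / a q N)) = ln (real N) - \<alpha> N / real p + \<alpha> N / real q"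
          using N by (simp add: ln_mult ln_div a_def)
        moreover have "\<alpha> N / real q \<ge> 0" using pos[OF N] by simp
        ultimately show ?thesis by linarith
      qed
      with S show ?thesis by blast
    qed
    show "(\<lambda>n. ln (real n) / \<alpha> n) \<longlonglongrightarrow> 0"
    proof (rule LIMSEQ_I)
      fix r :: real assume r: "r > 0"
      obtain p :: nat where p: "p \<ge> 1" "1 / real p < r / 2"
        using r by (metis half_gt_zero nat_approx_posE One_nat_def Suc_leI zero_less_Suc)
      from bound[OF p(1)] obtain S where S: "S > 0" "\<And>N. N \<ge> 1 \<Longrightarrow> ln (real N) \<le> ln S + \<alpha> N / real p"
        by blast
      have "eventually (\<lambda>n. \<alpha> n > 2 * ln S / r) sequentially"
        using lim by (simp add: filterlim_at_top_dense)
      then have "eventually (\<lambda>n. norm (ln (real n) / \<alpha> n - 0) < r) sequentially"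
        using eventually_ge_at_top[of 1]
      proof eventually_elim
        case (elim n)
        note a = pos[OF elim(2)]
        have "ln S < r / 2 * \<alpha> n" using elim(1) r by (simp add: field_simps)
        moreover have "\<alpha> n / real p \<le> r / 2 * \<alpha> n"
          using mult_right_mono[of "1 / real p" "r / 2" "\<alpha> n"] p a by simp
        ultimately have "ln (real n) < r * \<alpha> n" using S(2)[OF elim(2)] by linarith
        then show ?case using a elim(2) by (simp add: pos_divide_less_eq)
      qed
      then show "\<exists>no. \<forall>n\<ge>no. norm (ln (real n) / \<alpha> n - 0) < r"
        by (simp add: eventually_sequentially)
    qed
  qed
qed

definition stable_exponents :: "(nat \<Rightarrow> real) \<Rightarrow> bool" where
  "stable_exponents \<alpha> \<longleftrightarrow> bdd_above ((\<lambda>n. \<alpha> (2 * n) / \<alpha> n) ` {1..})"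

definition index_block :: "nat \<Rightarrow> nat set" where
  "index_block s = {s * (s + 1) div 2 + y * s + y * (y - 1) div 2 |y. True}"

lemma ex1_index_block:
  assumes "n \<ge> 1"
  shows "\<exists>!s. s \<ge> 1 \<and> n \<in> index_block s"
proof -
  define T where "T m = m * (m + 1) div 2" for m :: nat
  have T_Suc: "T (Suc m) = T m + Suc m" for m
    by (simp add: T_def algebra_simps)
  have T_mono: "T m \<le> T m'" if "m \<le> m'" for m m'
    unfolding T_def using that by (intro div_le_mono mult_le_mono) auto
  have T_add: "T (s + y) = T s + y * s + T y" for s y
    by (induction y) (simp_all add: T_Suc, simp_all add: T_def)
  have block: "s * (s + 1) div 2 + y * s + y * (y - 1) div 2 = T (s + y - 1) + s" if "s \<ge> 1" for s y
  proof (cases y)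
    case 0
    with that obtain r where "s = Suc r" by (cases s) auto
    with 0 T_Suc[of r] show ?thesis by (simp add: T_def)
  next
    case (Suc z)
    then show ?thesis using T_add[of s z] by (simp add: T_def algebra_simps)
  qed
  have mem: "n \<in> index_block s \<longleftrightarrow> (\<exists>m. s \<le> Suc m \<and> n = T m + s)" if s1: "s \<ge> 1" for s
  proof
    assume "n \<in> index_block s"
    then obtain y where "n = T (s + y - 1) + s"
      using block[OF s1] by (auto simp: index_block_def)
    then show "\<exists>m. s \<le> Suc m \<and> n = T m + s" using s1 by (intro exI[of _ "s + y - 1"]) auto
  next
    assume "\<exists>m. s \<le> Suc m \<and> n = T m + s"
    then obtain m where m: "s \<le> Suc m" "n = T m + s" by blast
    with block[OF s1, of "Suc m - s"] show "n \<in> index_block s"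
      by (auto simp: index_block_def intro!: exI[of _ "Suc m - s"])
  qed
  have "\<exists>m s. 1 \<le> s \<and> s \<le> Suc m \<and> n = T m + s"
    using assms
  proof (induction n rule: nat_induct_at_least)
    case base
    show ?case by (intro exI[of _ 0] exI[of _ 1]) (simp add: T_def)
  next
    case (Suc n)
    then obtain m s where ms: "1 \<le> s" "s \<le> Suc m" "n = T m + s" by blast
    show ?case
    proof (cases "s = Suc m")
      case True
      with ms show ?thesis by (intro exI[of _ "Suc m"] exI[of _ 1]) (simp add: T_Suc)
    next
      case False
      with ms show ?thesis by (intro exI[of _ m] exI[of _ "Suc s"]) auto
    qed
  qed
  moreover have "s = s'"
    if "1 \<le> s" "s \<le> Suc m" "n = T m + s" "1 \<le> s'" "s' \<le> Suc m'" "n = T m' + s'" for m s m' s'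
  proof -
    have "m = m'"
    proof (rule ccontr)
      assume "m \<noteq> m'"
      then consider "Suc m \<le> m'" | "Suc m' \<le> m" by linarith
      then show False
        using that T_mono[of "Suc m" m'] T_mono[of "Suc m'" m] by cases (auto simp: T_Suc)
    qed
    with that show ?thesis by simp
  qed
  ultimately show ?thesis using mem by metis
qed

definition block_of :: "nat \<Rightarrow> nat" where
  "block_of n = (THE s. s \<ge> 1 \<and> n \<in> index_block s)"

definition K_weight :: "(nat \<Rightarrow> real) \<Rightarrow> nat \<Rightarrow> nat \<Rightarrow> real" where
  "K_weight \<alpha> k n =
     (if k \<le> block_of n then exp (- (1 / real k) * \<alpha> n)
      else exp ((- (1 / real k) + 1) * \<alpha> n))"

definition K_space :: "(nat \<Rightarrow> real) \<Rightarrow> (nat \<Rightarrow> 'k::real_normed_field) graded_space" where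
  "K_space \<alpha> = koethe_space (K_weight \<alpha>)"

end

theory Submission
  imports Defs
begin

text \<open>
  Both spaces have the same two invariants because both satisfy the same two estimates, and these
  estimates already determine the invariants. Write \<open>U\<^sub>p\<close> for the unit balls.

  Upper estimate: \<open>d\<^sub>n(U\<^sub>q, U\<^sub>p) \<le> exp (- (1/p - 1/q) \<alpha>\<^sub>n\<^sub>+\<^sub>1)\<close> for \<open>p < q\<close>. In \<open>\<Lambda>\<^sub>1(\<alpha>)\<close> the quotient
  of the \<open>p\<close>-th and the \<open>q\<close>-th weight at \<open>i\<close> is \<open>exp (- (1/p - 1/q) \<alpha>\<^sub>i)\<close>; in \<open>K\<^sub>\<alpha>\<close> it is the same or,
  on the blocks where only the \<open>q\<close>-th weight carries the additional factor \<open>exp \<alpha>\<^sub>i\<close>, smaller. Cutting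
  off the first \<open>n\<close> coordinates gives the estimate.

  Lower estimate: there are a constant \<open>D\<close> and a single bounded set \<open>B\<close> with
  \<open>d\<^sub>n(B, U\<^sub>p) \<ge> exp (- (D/p) \<alpha>\<^sub>n\<^sub>+\<^sub>1)\<close> for all \<open>p\<close>. In \<open>\<Lambda>\<^sub>1(\<alpha>)\<close> the unit ball of \<open>l\<^sup>1\<close> would do, since the
  weights are at most \<open>1\<close>. In \<open>K\<^sub>\<alpha>\<close> the \<open>k\<close>-th weights are unbounded exactly on the blocks \<open>I\<^sub>s\<close> with
  \<open>s < k\<close>, so \<open>B\<close> is the part of that ball supported on a set \<open>J\<close> of indices that meets every block in
  a finite set. Nevertheless \<open>J\<close> can be chosen so dense that it has at least \<open>N\<close> elements up to \<open>8N\<close>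
  (\<open>front_dense\<close>), and stability bounds \<open>\<alpha>\<^sub>8\<^sub>N\<close> by \<open>D \<alpha>\<^sub>N\<close>. The diameter of \<open>B\<close> is then bounded below by
  linear algebra (\<open>covers_unit_ball_imp_ge\<close>).

  Since \<open>1/p\<close> can be made arbitrarily small, the two estimates yield, up to constants that do not
  affect null sequences, that \<open>(t\<^sub>n)\<close> belongs to the diametral dimension iff
  \<open>t\<^sub>n exp (- \<epsilon> \<alpha>\<^sub>n\<^sub>+\<^sub>1) \<rightarrow> 0\<close> for all \<open>\<epsilon> > 0\<close>, and to the approximate diametral dimension iff
  \<open>t\<^sub>n exp (\<epsilon> \<alpha>\<^sub>n\<^sub>+\<^sub>1) \<rightarrow> 0\<close> for some \<open>\<epsilon> > 0\<close>. Neither condition sees which of the two spaces is meant.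
\<close>

section \<open>Diameters as infima of covering radii\<close>

context scalar_space
begin

definition covers :: "'v graded_space \<Rightarrow> 'v set \<Rightarrow> 'v set \<Rightarrow> nat \<Rightarrow> real \<Rightarrow> bool" where
  "covers E V U n t \<longleftrightarrow> t > 0 \<and>
     (\<exists>S. finite S \<and> card S \<le> n \<and> span S \<subseteq> vectors E \<and>
          V \<subseteq> {of_real t \<cdot> u + l |u l. u \<in> U \<and> l \<in> span S})"

lemma diameter_eq_Inf_covers: "diameter E V U n = Inf {t. covers E V U n t}"
proof -
  have "(t > 0 \<and> (\<exists>L. subspace L \<and> L \<subseteq> vectors E \<and> (\<exists>S. finite S \<and> card S \<le> n \<and> span S = L) \<and>
            V \<subseteq> {of_real t \<cdot> u + l |u l. u \<in> U \<and> l \<in> L})) \<longleftrightarrow> covers E V U n t" for t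
    unfolding covers_def using subspace_span by blast
  then show ?thesis by (simp add: diameter_def)
qed

lemma diameter_le:
  assumes "covers E V U n t"
  shows "diameter E V U n \<le> t"
  unfolding diameter_eq_Inf_covers
  by (rule cInf_lower) (use assms in \<open>auto simp: covers_def intro!: bdd_belowI[of _ 0]\<close>)

lemma diameter_ge:
  assumes "covers E V U n t0" and "\<And>t. covers E V U n t \<Longrightarrow> m \<le> t"
  shows "m \<le> diameter E V U n"
  unfolding diameter_eq_Inf_covers
  by (rule cInf_greatest) (use assms in auto)

text \<open>
  Replacing \<open>V\<close> by a subset of \<open>c V\<close> and \<open>U\<close> by a superset of \<open>U / d\<close> multiplies covering radii by \<open>c d\<close>.
  Every zero neighbourhood contains a multiple of a unit ball and every bounded set is contained in
  a multiple of each unit ball, so all estimates can be transferred from unit balls.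
\<close>

lemma covers_rescale:
  assumes "covers E V U n t" and "c > 0" and "d > 0"
    and V': "\<And>x. x \<in> V' \<Longrightarrow> of_real (1 / c) \<cdot> x \<in> V"
    and U': "\<And>u. u \<in> U \<Longrightarrow> of_real (1 / d) \<cdot> u \<in> U'"
  shows "covers E V' U' n (c * d * t)"
proof -
  obtain S where t: "t > 0" and S: "finite S" "card S \<le> n" "span S \<subseteq> vectors E"
    and sub: "V \<subseteq> {of_real t \<cdot> u + l |u l. u \<in> U \<and> l \<in> span S}"
    using assms(1) unfolding covers_def by blast
  have "x \<in> {of_real (c * d * t) \<cdot> u + l |u l. u \<in> U' \<and> l \<in> span S}" if x: "x \<in> V'" for x
  proof -
    obtain u l where ul: "of_real (1 / c) \<cdot> x = of_real t \<cdot> u + l" "u \<in> U" "l \<in> span S"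
      using V'[OF x] sub by blast
    have "x = of_real c \<cdot> (of_real (1 / c) \<cdot> x)"
      using \<open>c > 0\<close> by (simp flip: of_real_mult)
    also have "\<dots> = of_real (c * d * t) \<cdot> (of_real (1 / d) \<cdot> u) + of_real c \<cdot> l"
      unfolding ul(1) using \<open>d > 0\<close>
      by (simp add: scale_right_distrib del: of_real_divide flip: of_real_mult)
    finally show ?thesis using U'[OF ul(2)] span_scale[OF ul(3)] by blast
  qed
  then show ?thesis unfolding covers_def using S t assms(2,3)
    by (intro conjI exI[of _ S]) auto
qed

text \<open>
  Linear dependence of a family, as opposed to a set: a repeated member also counts, with
  coefficients \<open>1\<close> and \<open>-1\<close>.
\<close>

lemma dependent_family:
  assumes "finite F" and "finite S" and "card S < card F" and "\<And>j. j \<in> F \<Longrightarrow> l j \<in> span S"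
  obtains c where "\<exists>j\<in>F. c j \<noteq> 0" and "(\<Sum>j\<in>F. c j \<cdot> l j) = 0"
proof (cases "inj_on l F")
  case True
  have "dependent (l ` F)"
  proof (rule ccontr)
    assume "\<not> dependent (l ` F)"
    then have "card (l ` F) \<le> card S"
      using independent_span_bound[OF assms(2)] assms(4) by blast
    then show False using card_image[OF True] assms(3) by simp
  qed
  then obtain w where w: "\<exists>v\<in>l ` F. w v \<noteq> 0" "(\<Sum>v\<in>l ` F. w v \<cdot> v) = 0"
    using dependent_finite[of "l ` F"] assms(1) by auto
  show ?thesis
    by (rule that[of "w \<circ> l"]) (use w True in \<open>auto simp: sum.reindex\<close>)
next
  case False
  then obtain i j where ij: "i \<in> F" "j \<in> F" "i \<noteq> j" "l i = l j" by (auto simp: inj_on_def)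
  define c where "c k = (if k = i then 1 else if k = j then - 1 else 0 :: 'k)" for k
  have "(\<Sum>k\<in>F. c k \<cdot> l k) = (\<Sum>k\<in>{i, j}. c k \<cdot> l k)"
    by (rule sum.mono_neutral_right) (use assms(1) ij in \<open>auto simp: c_def\<close>)
  also have "\<dots> = 0" using ij by (simp add: c_def)
  finally show ?thesis using ij(1) by (intro that[of c]) (auto simp: c_def)
qed

end

section \<open>Koethe spaces\<close>

lemma mem_koethe_space:
  "x \<in> vectors (koethe_space a) \<longleftrightarrow> x 0 = 0 \<and> (\<forall>k\<ge>1. summable (\<lambda>n. norm (x n) * a k n))"
  by (simp add: koethe_space_def)

lemma koethe_seminorm: "seminorm (koethe_space a) k x = (\<Sum>n. norm (x n) * a k n)"
  by (simp add: koethe_space_def)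

lemma koethe_seminorm_scale:
  assumes "x \<in> vectors (koethe_space a)" "k \<ge> 1"
  shows "seminorm (koethe_space a) k (seq_scale c x) = norm c * seminorm (koethe_space a) k x"
  using assms suminf_mult[of "\<lambda>n. norm (x n) * a k n" "norm c"]
  by (simp add: koethe_seminorm mem_koethe_space seq_scale_def norm_mult mult.assoc)

definition unit_vec :: "nat \<Rightarrow> nat \<Rightarrow> 'k::real_normed_field" where
  "unit_vec j = (\<lambda>n. if n = j then 1 else 0)"

lemma unit_vec_sums:
  "(\<lambda>n. norm (unit_vec j n :: 'k::real_normed_field) * w n) sums w j"
proof -
  have "(\<lambda>n. norm (unit_vec j n :: 'k) * w n) = (\<lambda>n. if n = j then w n else 0)"
    by (auto simp: unit_vec_def)
  then show ?thesis using sums_single[of j w] by simp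
qed

lemma unit_vec_in_koethe_space:
  "j \<ge> 1 \<Longrightarrow> (unit_vec j :: nat \<Rightarrow> 'k::real_normed_field) \<in> vectors (koethe_space a)"
  using sums_summable[OF unit_vec_sums] by (auto simp: mem_koethe_space unit_vec_def)

lemma sum_fun_apply: "(\<Sum>j\<in>A. g j) n = (\<Sum>j\<in>A. g j n)" for g :: "'j \<Rightarrow> 'n \<Rightarrow> 'k::comm_monoid_add"
  by (induction A rule: infinite_finite_induct) auto

lemma sum_unit_vec_apply:
  assumes "finite F"
  shows "(\<Sum>j\<in>F. seq_scale (c j) (unit_vec j)) n = (if n \<in> F then c n else 0)"
  using assms by (simp add: sum_fun_apply seq_scale_def unit_vec_def if_distrib[of "(*) _"] cong: if_cong)

lemma koethe_add:
  fixes x y :: "nat \<Rightarrow> 'k::real_normed_field"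
  assumes nn: "\<And>k n. 0 \<le> a k n"
    and x: "x \<in> vectors (koethe_space a)" and y: "y \<in> vectors (koethe_space a)"
  shows "x + y \<in> vectors (koethe_space a)"
    and "k \<ge> 1 \<Longrightarrow> seminorm (koethe_space a) k (x + y)
           \<le> seminorm (koethe_space a) k x + seminorm (koethe_space a) k y"
proof -
  have le: "norm ((x + y) n) * a k n \<le> norm (x n) * a k n + norm (y n) * a k n" for k n
    using mult_right_mono[OF norm_triangle_ineq[of "x n" "y n"] nn[of k n]]
    by (simp add: distrib_right)
  have sm: "summable (\<lambda>n. norm (x n) * a k n)" "summable (\<lambda>n. norm (y n) * a k n)" if "k \<ge> 1" for k
    using x y that by (auto simp: mem_koethe_space)
  have s: "summable (\<lambda>n. norm ((x + y) n) * a k n)" if "k \<ge> 1" for k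
    by (rule summable_comparison_test'[OF summable_add[OF sm[OF that]]])
       (use le nn in \<open>simp add: abs_mult\<close>)
  then show "x + y \<in> vectors (koethe_space a)" using x y by (simp add: mem_koethe_space)
  show "seminorm (koethe_space a) k (x + y)
           \<le> seminorm (koethe_space a) k x + seminorm (koethe_space a) k y" if "k \<ge> 1"
    unfolding koethe_seminorm suminf_add[OF sm[OF that]]
    by (intro suminf_le le s that summable_add sm)
qed

lemma subspace_koethe_space:
  assumes "\<And>k n. 0 \<le> a k n"
  shows "seq.subspace (vectors (koethe_space a :: (nat \<Rightarrow> 'k::real_normed_field) graded_space))"
  unfolding seq.subspace_def
  proof (intro conjI ballI allI)
  show "seq_scale c x \<in> vectors (koethe_space a)"
    if "x \<in> vectors (koethe_space a)" for c and x :: "nat \<Rightarrow> 'k"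
    using that by (auto simp: mem_koethe_space seq_scale_def norm_mult mult.assoc intro!: summable_mult)
qed (use koethe_add(1)[of a] assms in \<open>auto simp: mem_koethe_space\<close>)

lemma koethe_seminorm_sum_le:
  fixes x :: "'i \<Rightarrow> nat \<Rightarrow> 'k::real_normed_field"
  assumes nn: "\<And>k n. 0 \<le> a k n" and k: "k \<ge> 1"
    and x: "\<And>i. i \<in> A \<Longrightarrow> x i \<in> vectors (koethe_space a)"
  shows "seminorm (koethe_space a) k (\<Sum>i\<in>A. x i) \<le> (\<Sum>i\<in>A. seminorm (koethe_space a) k (x i))"
  using x
proof (induction A rule: infinite_finite_induct)
  case (insert i A)
  have "(\<Sum>i\<in>A. x i) \<in> vectors (koethe_space a)"
    using insert.prems by (intro seq.subspace_sum subspace_koethe_space nn) auto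
  moreover have "x i \<in> vectors (koethe_space a)" using insert.prems by simp
  ultimately have "seminorm (koethe_space a) k (x i + (\<Sum>i\<in>A. x i))
      \<le> seminorm (koethe_space a) k (x i) + seminorm (koethe_space a) k (\<Sum>i\<in>A. x i)"
    using nn k by (intro koethe_add(2))
  also have "\<dots> \<le> seminorm (koethe_space a) k (x i) + (\<Sum>i\<in>A. seminorm (koethe_space a) k (x i))"
    using insert.IH insert.prems by simp
  finally show ?case by (simp only: sum.insert[OF insert.hyps])
qed (simp_all add: koethe_seminorm)

lemma absolutely_convex_unit_ball:
  assumes nn: "\<And>k n. 0 \<le> a k n" and k: "k \<ge> 1"
  shows "seq.absolutely_convex (unit_ball (koethe_space a :: (nat \<Rightarrow> 'k::real_normed_field) graded_space) k)"
  unfolding seq.absolutely_convex_def unit_ball_def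
proof (safe, goal_cases)
  case (1 x y b c)
  then show ?case
    by (intro seq.subspace_add seq.subspace_scale subspace_koethe_space nn)
next
  case (2 x y b c)
  let ?E = "koethe_space a :: (nat \<Rightarrow> 'k) graded_space"
  have "seminorm ?E k (seq_scale b x + seq_scale c y)
      \<le> seminorm ?E k (seq_scale b x) + seminorm ?E k (seq_scale c y)"
    using 2 k by (intro koethe_add(2) nn seq.subspace_scale subspace_koethe_space)
  also have "\<dots> \<le> norm b * 1 + norm c * 1"
    using 2 k by (simp only: koethe_seminorm_scale) (intro add_mono mult_left_mono, auto)
  finally show ?case using 2 by simp
qed

text \<open>
  The lower bound for diameters reduces to linear algebra, because in a seminorm of \<open>l\<^sup>1\<close> type linear
  combinations of unit vectors have the largest seminorm that their coefficients permit, so that it is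
  enough to test \<open>V\<close> on unit vectors. Approximate each of the \<open>n + 1\<close> unit vectors as \<open>e\<^sub>j = t u\<^sub>j + l\<^sub>j\<close> with \<open>l\<^sub>j\<close> in an \<open>n\<close>-dimensional space. The \<open>l\<^sub>j\<close> are
  dependent, say \<open>\<Sum> c\<^sub>j l\<^sub>j = 0\<close>, so \<open>\<Sum> c\<^sub>j e\<^sub>j = t \<Sum> c\<^sub>j u\<^sub>j\<close>. The seminorm of the left side is at least
  \<open>m \<Sum> |c\<^sub>j|\<close>, that of the right side at most \<open>t \<Sum> |c\<^sub>j|\<close>.
\<close>

lemma covers_unit_ball_imp_ge:
  fixes V :: "(nat \<Rightarrow> 'k::real_normed_field) set"
  assumes nn: "\<And>k n. 0 \<le> a k n" and p: "p \<ge> 1"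
    and F: "finite F" "card F = Suc n"
    and V: "\<And>j. j \<in> F \<Longrightarrow> unit_vec j \<in> V"
    and m: "\<And>j. j \<in> F \<Longrightarrow> m \<le> a p j"
    and cov: "seq.covers (koethe_space a) V (unit_ball (koethe_space a) p) n t"
  shows "m \<le> t"
proof -
  let ?E = "koethe_space a :: (nat \<Rightarrow> 'k) graded_space"
  obtain S where t: "t > 0" and S: "finite S" "card S \<le> n"
    and sub: "V \<subseteq> {seq_scale (of_real t) u + l |u l. u \<in> unit_ball ?E p \<and> l \<in> seq.span S}"
    using cov unfolding seq.covers_def by blast
  have "\<forall>j\<in>F. \<exists>u l. unit_vec j = seq_scale (of_real t) u + l \<and> u \<in> unit_ball ?E p \<and> l \<in> seq.span S"
    using V sub by blast
  then obtain u l where ul: "\<And>j. j \<in> F \<Longrightarrow> unit_vec j = seq_scale (of_real t) (u j) + l j"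
    and u: "\<And>j. j \<in> F \<Longrightarrow> u j \<in> unit_ball ?E p" and l: "\<And>j. j \<in> F \<Longrightarrow> l j \<in> seq.span S"
    by metis
  obtain c where c: "\<exists>j\<in>F. c j \<noteq> 0" and c0: "(\<Sum>j\<in>F. seq_scale (c j) (l j)) = 0"
    by (rule seq.dependent_family[OF F(1) S(1) _ l]) (use F S in auto)
  define x where "x = (\<Sum>j\<in>F. seq_scale (c j) (unit_vec j))"
  have x_eq: "x = (\<Sum>j\<in>F. seq_scale (c j * of_real t) (u j))"
  proof -
    have "x = (\<Sum>j\<in>F. seq_scale (c j * of_real t) (u j) + seq_scale (c j) (l j))"
      unfolding x_def by (rule sum.cong) (auto simp: ul seq.scale_right_distrib)
    then show ?thesis by (simp add: sum.distrib c0)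
  qed
  have pos: "(\<Sum>j\<in>F. norm (c j)) > 0"
    using c F(1) by (meson norm_ge_zero sum_pos2 zero_less_norm_iff)
  have "(\<Sum>j\<in>F. norm (c j)) * m \<le> (\<Sum>j\<in>F. norm (c j) * a p j)"
    unfolding sum_distrib_right using m by (intro sum_mono mult_left_mono) auto
  also have "\<dots> = seminorm ?E p x"
  proof -
    have "(\<lambda>n. norm (x n) * a p n) = (\<lambda>n. if n \<in> F then norm (c n) * a p n else 0)"
      by (auto simp: x_def sum_unit_vec_apply F)
    then show ?thesis
      using sums_If_finite_set[OF F(1), of "\<lambda>n. norm (c n) * a p n"]
      by (simp add: koethe_seminorm sums_iff)
  qed
  also have "\<dots> \<le> (\<Sum>j\<in>F. seminorm ?E p (seq_scale (c j * of_real t) (u j)))"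
    unfolding x_eq using u
    by (intro koethe_seminorm_sum_le nn p seq.subspace_scale[OF subspace_koethe_space[OF nn]])
       (auto simp: unit_ball_def)
  also have "\<dots> \<le> (\<Sum>j\<in>F. norm (c j) * t)"
  proof (rule sum_mono)
    fix j assume "j \<in> F"
    then show "seminorm ?E p (seq_scale (c j * of_real t) (u j)) \<le> norm (c j) * t"
      using u[of j] t p mult_left_mono[of "seminorm ?E p (u j)" 1 "norm (c j) * t"]
      by (simp add: koethe_seminorm_scale unit_ball_def norm_mult)
  qed
  also have "\<dots> = (\<Sum>j\<in>F. norm (c j)) * t" by (simp add: sum_distrib_right)
  finally show "m \<le> t" using pos by simp
qed

text \<open>
  The subspace spanned by the first \<open>n\<close> unit vectors absorbs the head of a sequence; the tail has
  \<open>p\<close>-th seminorm at most \<open>t\<close> times the \<open>q\<close>-th.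
\<close>

lemma covers_unit_balls_tail:
  assumes nn: "\<And>k n. 0 \<le> a k n" and pq: "p \<ge> 1" "q \<ge> 1" and t: "t > 0"
    and tail: "\<And>i. i > n \<Longrightarrow> a p i \<le> t * a q i"
  shows "seq.covers (koethe_space a :: (nat \<Rightarrow> 'k::real_normed_field) graded_space)
           (unit_ball (koethe_space a) q) (unit_ball (koethe_space a) p) n t"
proof -
  let ?E = "koethe_space a :: (nat \<Rightarrow> 'k) graded_space"
  let ?S = "unit_vec ` {1..n} :: (nat \<Rightarrow> 'k) set"
  note sub = subspace_koethe_space[OF nn, where ?'k = 'k]
  have S: "seq.span ?S \<subseteq> vectors ?E"
    using unit_vec_in_koethe_space by (intro seq.span_minimal sub) auto
  have "x \<in> {seq_scale (of_real t) u + l |u l. u \<in> unit_ball ?E p \<and> l \<in> seq.span ?S}"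
    if x: "x \<in> unit_ball ?E q" for x
  proof -
    define l where "l = (\<Sum>j\<in>{1..n}. seq_scale (x j) (unit_vec j))"
    define r where "r = x - l"
    have l: "l \<in> seq.span ?S"
      unfolding l_def by (intro seq.span_sum seq.span_scale seq.span_base) auto
    have xE: "x \<in> vectors ?E" and x1: "(\<Sum>i. norm (x i) * a q i) \<le> 1"
      using x by (auto simp: unit_ball_def koethe_seminorm)
    have rE: "r \<in> vectors ?E" unfolding r_def using xE l S by (intro seq.subspace_diff sub) auto
    have le: "norm (r i) * a p i \<le> t * (norm (x i) * a q i)" for i
    proof (cases "i > n")
      case True
      then show ?thesis using mult_left_mono[OF tail[OF True], of "norm (x i)"]
        by (simp add: r_def l_def sum_unit_vec_apply mult_ac)
    next
      case False
      moreover have "x 0 = 0" using xE by (simp add: mem_koethe_space)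
      ultimately have "r i = 0"
        by (cases "i = 0") (auto simp: r_def l_def sum_unit_vec_apply)
      then show ?thesis using nn[of q i] t by simp
    qed
    have "seminorm ?E p r \<le> (\<Sum>i. t * (norm (x i) * a q i))"
      unfolding koethe_seminorm using rE xE pq
      by (intro suminf_le le summable_mult) (auto simp: mem_koethe_space)
    also have "\<dots> = t * (\<Sum>i. norm (x i) * a q i)"
      using xE pq by (intro suminf_mult) (auto simp: mem_koethe_space)
    also have "\<dots> \<le> t" using x1 t mult_left_mono[of _ 1 t] by simp
    finally have r: "seminorm ?E p r \<le> t" .
    define u where "u = seq_scale (of_real (1 / t)) r"
    have "u \<in> unit_ball ?E p"
      unfolding u_def unit_ball_def using rE sub r t pq
      by (auto simp: koethe_seminorm_scale seq.subspace_def norm_divide simp del: of_real_divide)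
    moreover have "x = seq_scale (of_real t) u + l"
      using t by (simp add: u_def r_def flip: of_real_mult)
    ultimately show ?thesis using l by blast
  qed
  moreover have "card ?S \<le> n" using card_image_le[of "{1..n}"] by simp
  ultimately show ?thesis unfolding seq.covers_def using t S by (intro conjI exI[of _ ?S]) auto
qed


lemma ennreal_divide_antimono:
  fixes a b c :: ennreal
  assumes "a \<le> b"
  shows "c / b \<le> c / a"
proof -
  have "inverse b \<le> inverse a"
  proof (cases "a = 0 \<or> b = top")
    case True
    then show ?thesis by auto
  next
    case False
    then obtain r s where rs: "0 < r" "a = ennreal r" "0 \<le> s" "b = ennreal s"
      using assms by (cases a; cases b) (auto simp: top_unique less_le)
    then have "r \<le> s" using assms by simp
    then show ?thesis using rs by (simp add: inverse_ennreal le_imp_inverse_le)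
  qed
  then show ?thesis unfolding divide_ennreal_def by (intro mult_left_mono) auto
qed

section \<open>Koethe spaces comparable with a power series space of finite type\<close>

text \<open>
  A common setting for both spaces. The bound on weight ratios gives the upper estimate. For the lower
  one, \<open>bounded_on_J\<close> makes the unit vectors over \<open>J\<close> a bounded set, \<open>weight_ge\<close> keeps their seminorms
  from being small, and \<open>J_dense\<close> says that there are many of them: the constant \<open>D\<close> is the price for
  skipping the indices outside \<open>J\<close>.
\<close>

locale finite_type_weights =
  fixes a :: "nat \<Rightarrow> nat \<Rightarrow> real" and \<alpha> :: "nat \<Rightarrow> real" and J :: "nat set" and D :: real
  assumes weight_pos: "0 < a k n"
    and weight_ratio: "1 \<le> p \<Longrightarrow> p < q \<Longrightarrow> 1 \<le> n \<Longrightarrow>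
           a p n \<le> exp (- ((1 / real p - 1 / real q) * \<alpha> n)) * a q n"
    and weight_ge: "1 \<le> p \<Longrightarrow> 1 \<le> n \<Longrightarrow> exp (- (\<alpha> n / real p)) \<le> a p n"
    and exponent_pos: "1 \<le> n \<Longrightarrow> 0 < \<alpha> n"
    and exponent_mono: "1 \<le> m \<Longrightarrow> m \<le> n \<Longrightarrow> \<alpha> m \<le> \<alpha> n"
    and D_pos: "0 < D"
    and bounded_on_J: "1 \<le> k \<Longrightarrow> \<exists>C. \<forall>j\<in>J. a k j \<le> C"
    and J_dense: "\<exists>F\<subseteq>J. finite F \<and> card F = Suc n \<and> (\<forall>j\<in>F. 1 \<le> j \<and> \<alpha> j \<le> D * \<alpha> (Suc n))"
begin

lemma weight_nonneg: "0 \<le> a k n"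
  using weight_pos by (rule less_imp_le)

definition J_ball :: "(nat \<Rightarrow> 'k::real_normed_field) set" where
  "J_ball = unit_ball (koethe_space (\<lambda>k n. 1)) 1 \<inter> {x. \<forall>n. n \<notin> J \<longrightarrow> x n = 0}"

lemma absolutely_convex_J_ball: "seq.absolutely_convex (J_ball :: (nat \<Rightarrow> 'k::real_normed_field) set)"
  using absolutely_convex_unit_ball[of "\<lambda>k n. 1" 1, where ?'k = 'k]
  unfolding J_ball_def seq.absolutely_convex_def by (auto simp: seq_scale_def)

lemma unit_vec_in_J_ball:
  "j \<in> J \<Longrightarrow> 1 \<le> j \<Longrightarrow> (unit_vec j :: nat \<Rightarrow> 'k::real_normed_field) \<in> J_ball"
  using unit_vec_in_koethe_space[of j "\<lambda>k n. 1", where ?'k = 'k]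
    unit_vec_sums[of j "\<lambda>n. 1", where ?'k = 'k]
  unfolding J_ball_def unit_ball_def
  by (auto simp: koethe_seminorm sums_iff) (auto simp: unit_vec_def)

lemma bounded_J_ball: "bounded_subset (koethe_space a) (J_ball :: (nat \<Rightarrow> 'k::real_normed_field) set)"
proof -
  have *: "summable (\<lambda>n. norm (x n) * a k n) \<and> (\<Sum>n. norm (x n) * a k n) \<le> C"
    if x: "x \<in> (J_ball :: (nat \<Rightarrow> 'k) set)" and k: "1 \<le> k" and C: "\<forall>j\<in>J. a k j \<le> C" "0 \<le> C"
    for x k C
  proof -
    have s: "summable (\<lambda>n. norm (x n))" and le1: "(\<Sum>n. norm (x n)) \<le> 1"
      using x by (auto simp: J_ball_def unit_ball_def mem_koethe_space koethe_seminorm)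
    have le: "norm (x n) * a k n \<le> C * norm (x n)" for n
      using x C mult_right_mono[of "a k n" C "norm (x n)"]
      by (cases "n \<in> J") (auto simp: J_ball_def mult.commute)
    have S: "summable (\<lambda>n. norm (x n) * a k n)"
      by (rule summable_comparison_test'[OF summable_mult[OF s, of C]])
         (use le weight_pos in \<open>simp add: abs_mult less_imp_le\<close>)
    have "(\<Sum>n. norm (x n) * a k n) \<le> (\<Sum>n. C * norm (x n))"
      by (intro suminf_le le S summable_mult s)
    also have "\<dots> \<le> C" using le1 C(2) mult_left_mono[of _ 1 C] by (simp add: suminf_mult[OF s])
    finally show ?thesis using S by simp
  qed
  have **: "\<exists>C\<ge>0. \<forall>j\<in>J. a k j \<le> C" if "1 \<le> k" for k
    using bounded_on_J[OF that] by (meson dual_order.trans linorder_linear)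
  show ?thesis
    unfolding bounded_subset_def
  proof safe
    fix x :: "nat \<Rightarrow> 'k" assume x: "x \<in> J_ball"
    have "summable (\<lambda>n. norm (x n) * a k n)" if "1 \<le> k" for k
      using *[OF x that] **[OF that] by blast
    moreover have "x 0 = 0" using x by (simp add: J_ball_def unit_ball_def mem_koethe_space)
    ultimately show "x \<in> vectors (koethe_space a)" by (simp add: mem_koethe_space)
  next
    fix k :: nat assume k: "1 \<le> k"
    then show "\<exists>C. \<forall>x\<in>(J_ball :: (nat \<Rightarrow> 'k) set). seminorm (koethe_space a) k x \<le> C"
      using *[OF _ k] **[OF k] unfolding koethe_seminorm by blast
  qed
qed

lemma covers_unit_balls:
  assumes "1 \<le> p" "p < q"
  shows "seq.covers (koethe_space a :: (nat \<Rightarrow> 'k::real_normed_field) graded_space)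
           (unit_ball (koethe_space a) q) (unit_ball (koethe_space a) p) n
           (exp (- ((1 / real p - 1 / real q) * \<alpha> (Suc n))))"
proof (rule covers_unit_balls_tail)
  fix i assume i: "n < i"
  have "1 / real q \<le> 1 / real p" using assms by (simp add: frac_le)
  then have "(1 / real p - 1 / real q) * \<alpha> (Suc n) \<le> (1 / real p - 1 / real q) * \<alpha> i"
    using i by (intro mult_left_mono exponent_mono) auto
  then have "exp (- ((1 / real p - 1 / real q) * \<alpha> i)) * a q i
      \<le> exp (- ((1 / real p - 1 / real q) * \<alpha> (Suc n))) * a q i"
    using weight_pos[of q i] by (intro mult_right_mono) auto
  then show "a p i \<le> exp (- ((1 / real p - 1 / real q) * \<alpha> (Suc n))) * a q i"
    using weight_ratio[OF assms, of i] i by linarith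
qed (use assms weight_pos in \<open>auto simp: less_imp_le\<close>)

text \<open>
  Test on the \<open>n + 1\<close> unit vectors provided by \<open>J_dense\<close>. As \<open>D\<close> does not depend on \<open>p\<close>, the rate \<open>D / p\<close>
  falls below any prescribed one for large \<open>p\<close>.
\<close>

lemma J_ball_covers_ge:
  assumes p: "1 \<le> p"
    and cov: "seq.covers (koethe_space a :: (nat \<Rightarrow> 'k::real_normed_field) graded_space)
           J_ball (unit_ball (koethe_space a) p) n t"
  shows "exp (- (D / real p * \<alpha> (Suc n))) \<le> t"
proof -
  obtain F where F: "F \<subseteq> J" "finite F" "card F = Suc n" and
    le: "\<And>j. j \<in> F \<Longrightarrow> 1 \<le> j" "\<And>j. j \<in> F \<Longrightarrow> \<alpha> j \<le> D * \<alpha> (Suc n)"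
    using J_dense by metis
  show ?thesis
  proof (rule covers_unit_ball_imp_ge[OF weight_nonneg p F(2,3) _ _ cov])
    show "unit_vec j \<in> J_ball" if "j \<in> F" for j
      using that F le by (intro unit_vec_in_J_ball) auto
    show "exp (- (D / real p * \<alpha> (Suc n))) \<le> a p j" if "j \<in> F" for j
    proof -
      have "\<alpha> j / real p \<le> D / real p * \<alpha> (Suc n)"
        using divide_right_mono[OF le(2)[OF that], of "real p"] by simp
      then have "exp (- (D / real p * \<alpha> (Suc n))) \<le> exp (- (\<alpha> j / real p))" by simp
      also have "\<dots> \<le> a p j" using weight_ge p le(1) that by blast
      finally show ?thesis .
    qed
  qed
qed

lemma bounded_imp_scaled_in_unit_ball:
  assumes B: "bounded_subset (koethe_space a) (B :: (nat \<Rightarrow> 'k::real_normed_field) set)" and q: "1 \<le> q"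
  obtains c where "c > 0" "\<And>x. x \<in> B \<Longrightarrow> seq_scale (of_real (1 / c)) x \<in> unit_ball (koethe_space a) q"
proof -
  obtain C where C: "\<And>x. x \<in> B \<Longrightarrow> seminorm (koethe_space a) q x \<le> C" and
    BE: "B \<subseteq> vectors (koethe_space a)"
    using B q unfolding bounded_subset_def by blast
  define c where "c = max C 1"
  show ?thesis
  proof (rule that[of c])
    show "c > 0" by (simp add: c_def)
    fix x assume x: "x \<in> B"
    then have xE: "x \<in> vectors (koethe_space a)" using BE by blast
    have "seminorm (koethe_space a) q (seq_scale (of_real (1 / c)) x) = (1 / c) * seminorm (koethe_space a) q x"
      using \<open>c > 0\<close> by (simp add: koethe_seminorm_scale[OF xE q] norm_divide)
    also have "\<dots> \<le> 1" using C[OF x] \<open>c > 0\<close> by (simp add: c_def)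
    finally show "seq_scale (of_real (1 / c)) x \<in> unit_ball (koethe_space a) q"
      unfolding unit_ball_def using xE
      by (auto intro!: seq.subspace_scale subspace_koethe_space weight_nonneg)
  qed
qed

text \<open>
  If \<open>t\<close> is in the diametral dimension and \<open>\<epsilon> > 0\<close>, take \<open>p \<ge> D / \<epsilon>\<close>: whatever \<open>q\<close> the definition
  supplies, \<open>d\<^sub>n(U\<^sub>q, U\<^sub>p)\<close> is at least a multiple of \<open>d\<^sub>n(J_ball, U\<^sub>p)\<close>. Conversely, for given \<open>p\<close> the
  choice \<open>q = p + 1\<close> suffices, with \<open>\<epsilon> = 1/p - 1/q\<close>.
\<close>

lemma diametral_dimension_eq:
  "seq.diametral_dimension (koethe_space a :: (nat \<Rightarrow> 'k::real_normed_field) graded_space)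
     = {t. \<forall>\<epsilon>>0. (\<lambda>n. norm (t n) * exp (- (\<epsilon> * \<alpha> (Suc n)))) \<longlonglongrightarrow> 0}"
proof (intro set_eqI iffI CollectI allI impI)
  fix t :: "nat \<Rightarrow> 'k" and \<epsilon> :: real
  assume t: "t \<in> seq.diametral_dimension (koethe_space a :: (nat \<Rightarrow> 'k) graded_space)" and "\<epsilon> > 0"
  let ?E = "koethe_space a :: (nat \<Rightarrow> 'k) graded_space"
  obtain p :: nat where p: "1 \<le> p" "1 / real p < \<epsilon> / D"
    using \<open>\<epsilon> > 0\<close> D_pos nat_approx_posE[of "\<epsilon> / D"]
    by (metis One_nat_def Suc_leI divide_pos_pos zero_less_Suc)
  then have Dp: "D / real p \<le> \<epsilon>" using D_pos by (simp add: field_simps)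
  let ?d = "\<lambda>q n. seq.diameter ?E (unit_ball ?E q) (unit_ball ?E p) n"
  obtain q where q: "p < q" and lim: "(\<lambda>n. t n * of_real (?d q n)) \<longlonglongrightarrow> 0"
    using t p(1) unfolding seq.diametral_dimension_def by blast
  obtain c where c: "c > 0" "\<And>x. x \<in> J_ball \<Longrightarrow> seq_scale (of_real (1 / c)) x \<in> unit_ball ?E q"
    using bounded_imp_scaled_in_unit_ball[OF bounded_J_ball, of q] p q by auto
  have d_ge: "exp (- (\<epsilon> * \<alpha> (Suc n))) \<le> c * ?d q n" for n
  proof -
    have "exp (- (\<epsilon> * \<alpha> (Suc n))) / c \<le> ?d q n"
    proof (rule seq.diameter_ge[OF covers_unit_balls[OF p(1) q]])
      fix r assume "seq.covers ?E (unit_ball ?E q) (unit_ball ?E p) n r"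
      then have "seq.covers ?E J_ball (unit_ball ?E p) n (c * 1 * r)"
        by (rule seq.covers_rescale) (use c in auto)
      then have "exp (- (D / real p * \<alpha> (Suc n))) \<le> c * r"
        using J_ball_covers_ge[OF p(1)] by simp
      moreover have "D / real p * \<alpha> (Suc n) \<le> \<epsilon> * \<alpha> (Suc n)"
        using Dp exponent_pos[of "Suc n"] by (intro mult_right_mono) auto
      ultimately have "exp (- (\<epsilon> * \<alpha> (Suc n))) \<le> c * r" by (smt (verit) exp_le_cancel_iff)
      then show "exp (- (\<epsilon> * \<alpha> (Suc n))) / c \<le> r" using c(1) by (simp add: field_simps)
    qed
    then show ?thesis using c(1) by (simp add: field_simps)
  qed
  show "(\<lambda>n. norm (t n) * exp (- (\<epsilon> * \<alpha> (Suc n)))) \<longlonglongrightarrow> 0"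
  proof (rule Lim_null_comparison)
    show "\<forall>\<^sub>F n in sequentially. norm (norm (t n) * exp (- (\<epsilon> * \<alpha> (Suc n))))
            \<le> c * norm (t n * of_real (?d q n))"
    proof (rule always_eventually, rule allI)
      fix n
      have "norm (t n) * exp (- (\<epsilon> * \<alpha> (Suc n))) \<le> norm (t n) * (c * \<bar>?d q n\<bar>)"
        using order_trans[OF d_ge[of n] mult_left_mono[OF abs_ge_self less_imp_le[OF c(1)]]]
        by (intro mult_left_mono) auto
      then show "norm (norm (t n) * exp (- (\<epsilon> * \<alpha> (Suc n)))) \<le> c * norm (t n * of_real (?d q n))"
        by (simp add: norm_mult mult_ac)
    qed
    show "(\<lambda>n. c * norm (t n * of_real (?d q n))) \<longlonglongrightarrow> 0"
      by (rule tendsto_mult_right_zero) (rule tendsto_norm_zero[OF lim])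
  qed
next
  fix t :: "nat \<Rightarrow> 'k"
  assume "t \<in> {t. \<forall>\<epsilon>>0. (\<lambda>n. norm (t n) * exp (- (\<epsilon> * \<alpha> (Suc n)))) \<longlonglongrightarrow> 0}"
  then have t: "\<And>\<epsilon>. \<epsilon> > 0 \<Longrightarrow> (\<lambda>n. norm (t n) * exp (- (\<epsilon> * \<alpha> (Suc n)))) \<longlonglongrightarrow> 0" by simp
  let ?E = "koethe_space a :: (nat \<Rightarrow> 'k) graded_space"
  show "t \<in> seq.diametral_dimension ?E"
    unfolding seq.diametral_dimension_def
  proof (intro CollectI allI impI exI conjI)
    fix p :: nat assume p: "1 \<le> p"
    let ?d = "\<lambda>n. seq.diameter ?E (unit_ball ?E (Suc p)) (unit_ball ?E p) n"
    define \<epsilon> where "\<epsilon> = 1 / real p - 1 / real (Suc p)"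
    have \<epsilon>: "\<epsilon> > 0" unfolding \<epsilon>_def using p by (simp add: frac_less2)
    show "p < Suc p" by simp
    have d: "0 \<le> ?d n" "?d n \<le> exp (- (\<epsilon> * \<alpha> (Suc n)))" for n
    proof -
      note cov = covers_unit_balls[OF p lessI, of n, where ?'k = 'k, folded \<epsilon>_def]
      show "?d n \<le> exp (- (\<epsilon> * \<alpha> (Suc n)))" by (rule seq.diameter_le[OF cov])
      show "0 \<le> ?d n" by (rule seq.diameter_ge[OF cov]) (simp add: seq.covers_def)
    qed
    show "(\<lambda>n. t n * of_real (?d n)) \<longlonglongrightarrow> 0"
    proof (rule Lim_null_comparison)
      show "\<forall>\<^sub>F n in sequentially. norm (t n * of_real (?d n)) \<le> norm (t n) * exp (- (\<epsilon> * \<alpha> (Suc n)))"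
        using d by (intro always_eventually allI) (simp add: norm_mult mult_left_mono)
    qed (rule t[OF \<epsilon>])
  qed
qed

lemma covers_bounded_zero_neighbourhood:
  assumes U: "zero_neighbourhood (koethe_space a) U"
    and B: "bounded_subset (koethe_space a) (B :: (nat \<Rightarrow> 'k::real_normed_field) set)"
  obtains c \<epsilon> where "c > 0" "\<epsilon> > 0"
    "\<And>n. seq.covers (koethe_space a) B U n (c * exp (- (\<epsilon> * \<alpha> (Suc n))))"
proof -
  let ?E = "koethe_space a :: (nat \<Rightarrow> 'k) graded_space"
  obtain p r where p: "1 \<le> p" and r: "r > 0" and sub: "{x \<in> vectors ?E. seminorm ?E p x < r} \<subseteq> U"
    using U unfolding zero_neighbourhood_def by blast
  obtain c where c: "c > 0" "\<And>x. x \<in> B \<Longrightarrow> seq_scale (of_real (1 / c)) x \<in> unit_ball ?E (Suc p)"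
    using bounded_imp_scaled_in_unit_ball[OF B, of "Suc p"] by auto
  define \<epsilon> where "\<epsilon> = 1 / real p - 1 / real (Suc p)"
  have \<epsilon>: "\<epsilon> > 0" unfolding \<epsilon>_def using p by (simp add: frac_less2)
  \<comment> \<open>Half the radius, since the neighbourhood is described by a strict inequality.\<close>
  have "seq_scale (of_real (1 / (2 / r))) u \<in> U" if "u \<in> unit_ball ?E p" for u
  proof -
    have uE: "u \<in> vectors ?E" and u1: "seminorm ?E p u \<le> 1" using that by (auto simp: unit_ball_def)
    have "seminorm ?E p (seq_scale (of_real (1 / (2 / r))) u) = (r / 2) * seminorm ?E p u"
      using r by (simp add: koethe_seminorm_scale[OF uE p] norm_divide)
    also have "\<dots> < r" using u1 r mult_left_mono[of "seminorm ?E p u" 1 "r / 2"] by simp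
    finally show ?thesis
      using uE seq.subspace_scale[OF subspace_koethe_space uE] weight_pos sub
      by (auto simp: less_imp_le)
  qed
  then have "seq.covers ?E B U n (c * (2 / r) * exp (- (\<epsilon> * \<alpha> (Suc n))))" for n
    unfolding \<epsilon>_def
    by (intro seq.covers_rescale[OF covers_unit_balls[OF p lessI]] c) (use r in auto)
  then show ?thesis using that[of "c * (2 / r)" \<epsilon>] c r \<epsilon> by auto
qed

text \<open>
  By the preceding lemma every \<open>d\<^sub>n(B, U)\<close> decays at some exponential rate in \<open>\<alpha>\<close>. Conversely, the pair
  \<open>J_ball\<close>, \<open>U\<^sub>p\<close> with \<open>p \<ge> D / \<epsilon>\<close> has diameters decaying no faster than \<open>exp (- \<epsilon> \<alpha>\<^sub>n\<^sub>+\<^sub>1)\<close>.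
\<close>

lemma approximate_diametral_dimension_eq:
  "seq.approximate_diametral_dimension (koethe_space a :: (nat \<Rightarrow> 'k::real_normed_field) graded_space)
     = {t. \<exists>\<epsilon>>0. (\<lambda>n. norm (t n) * exp (\<epsilon> * \<alpha> (Suc n))) \<longlonglongrightarrow> 0}"
proof (intro set_eqI iffI)
  fix t :: "nat \<Rightarrow> 'k"
  let ?E = "koethe_space a :: (nat \<Rightarrow> 'k) graded_space"
  assume "t \<in> seq.approximate_diametral_dimension ?E"
  then obtain U B where U: "zero_neighbourhood ?E U" and B: "bounded_subset ?E B" and
    lim: "(\<lambda>n. ennreal (norm (t n)) / ennreal (seq.diameter ?E B U n)) \<longlonglongrightarrow> 0"
    unfolding seq.approximate_diametral_dimension_def by blast
  obtain c \<epsilon> where c: "c > 0" and \<epsilon>: "\<epsilon> > 0" and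
    cov: "\<And>n. seq.covers ?E B U n (c * exp (- (\<epsilon> * \<alpha> (Suc n))))"
    using covers_bounded_zero_neighbourhood[OF U B] by blast
  have "(\<lambda>n. ennreal (norm (t n) / (c * exp (- (\<epsilon> * \<alpha> (Suc n)))))) \<longlonglongrightarrow> ennreal 0"
  proof (rule tendsto_sandwich[OF _ _ tendsto_const])
    show "\<forall>\<^sub>F n in sequentially. ennreal (norm (t n) / (c * exp (- (\<epsilon> * \<alpha> (Suc n)))))
            \<le> ennreal (norm (t n)) / ennreal (seq.diameter ?E B U n)"
    proof (rule always_eventually, rule allI)
      fix n
      have "ennreal (norm (t n) / (c * exp (- (\<epsilon> * \<alpha> (Suc n)))))
          = ennreal (norm (t n)) / ennreal (c * exp (- (\<epsilon> * \<alpha> (Suc n))))"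
        using c by (simp add: divide_ennreal)
      also have "\<dots> \<le> ennreal (norm (t n)) / ennreal (seq.diameter ?E B U n)"
        by (intro ennreal_divide_antimono ennreal_leI seq.diameter_le cov)
      finally show "ennreal (norm (t n) / (c * exp (- (\<epsilon> * \<alpha> (Suc n)))))
          \<le> ennreal (norm (t n)) / ennreal (seq.diameter ?E B U n)" .
    qed
  qed (use lim in auto)
  then have "(\<lambda>n. norm (t n) / (c * exp (- (\<epsilon> * \<alpha> (Suc n))))) \<longlonglongrightarrow> 0"
    by (subst (asm) tendsto_ennreal_iff) (use c in auto)
  from tendsto_mult_right_zero[OF this, of c]
  have "(\<lambda>n. norm (t n) * exp (\<epsilon> * \<alpha> (Suc n))) \<longlonglongrightarrow> 0"
    using c by (simp add: exp_minus field_simps)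
  then show "t \<in> {t. \<exists>\<epsilon>>0. (\<lambda>n. norm (t n) * exp (\<epsilon> * \<alpha> (Suc n))) \<longlonglongrightarrow> 0}" using \<epsilon> by blast
next
  fix t :: "nat \<Rightarrow> 'k"
  let ?E = "koethe_space a :: (nat \<Rightarrow> 'k) graded_space"
  assume "t \<in> {t. \<exists>\<epsilon>>0. (\<lambda>n. norm (t n) * exp (\<epsilon> * \<alpha> (Suc n))) \<longlonglongrightarrow> 0}"
  then obtain \<epsilon> where \<epsilon>: "\<epsilon> > 0" and lim: "(\<lambda>n. norm (t n) * exp (\<epsilon> * \<alpha> (Suc n))) \<longlonglongrightarrow> 0" by blast
  obtain p :: nat where p: "1 \<le> p" "1 / real p < \<epsilon> / D"
    using \<open>\<epsilon> > 0\<close> D_pos nat_approx_posE[of "\<epsilon> / D"]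
    by (metis One_nat_def Suc_leI divide_pos_pos zero_less_Suc)
  then have Dp: "D / real p \<le> \<epsilon>" using D_pos by (simp add: field_simps)
  let ?U = "unit_ball ?E p"
  have U: "zero_neighbourhood ?E ?U"
    unfolding zero_neighbourhood_def unit_ball_def using p(1)
    by (intro conjI exI[of _ p] exI[of _ 1]) auto
  have cov: "\<exists>r. seq.covers ?E J_ball ?U n r" for n
    using covers_bounded_zero_neighbourhood[OF U bounded_J_ball] by metis
  have d_ge: "exp (- (\<epsilon> * \<alpha> (Suc n))) \<le> seq.diameter ?E J_ball ?U n" for n
  proof -
    obtain r where r: "seq.covers ?E J_ball ?U n r" using cov by blast
    have "exp (- (\<epsilon> * \<alpha> (Suc n))) \<le> exp (- (D / real p * \<alpha> (Suc n)))"
      using mult_right_mono[OF Dp, of "\<alpha> (Suc n)"] exponent_pos[of "Suc n"] by simp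
    also have "\<dots> \<le> seq.diameter ?E J_ball ?U n"
      by (rule seq.diameter_ge[OF r J_ball_covers_ge[OF p(1)]])
    finally show ?thesis .
  qed
  have "(\<lambda>n. ennreal (norm (t n)) / ennreal (seq.diameter ?E J_ball ?U n)) \<longlonglongrightarrow> 0"
  proof (rule tendsto_sandwich[OF _ _ tendsto_const])
    show "\<forall>\<^sub>F n in sequentially. ennreal (norm (t n)) / ennreal (seq.diameter ?E J_ball ?U n)
            \<le> ennreal (norm (t n) * exp (\<epsilon> * \<alpha> (Suc n)))"
    proof (rule always_eventually, rule allI)
      fix n
      have "ennreal (norm (t n)) / ennreal (seq.diameter ?E J_ball ?U n)
          \<le> ennreal (norm (t n)) / ennreal (exp (- (\<epsilon> * \<alpha> (Suc n))))"
        by (intro ennreal_divide_antimono ennreal_leI d_ge)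
      also have "\<dots> = ennreal (norm (t n) * exp (\<epsilon> * \<alpha> (Suc n)))"
        by (simp add: divide_ennreal exp_minus divide_inverse)
      finally show "ennreal (norm (t n)) / ennreal (seq.diameter ?E J_ball ?U n)
          \<le> ennreal (norm (t n) * exp (\<epsilon> * \<alpha> (Suc n)))" .
    qed
    show "(\<lambda>n. ennreal (norm (t n) * exp (\<epsilon> * \<alpha> (Suc n)))) \<longlonglongrightarrow> 0"
      using tendsto_ennrealI[OF lim] by simp
  qed simp
  then show "t \<in> seq.approximate_diametral_dimension ?E"
    unfolding seq.approximate_diametral_dimension_def
    using U bounded_J_ball absolutely_convex_J_ball
      absolutely_convex_unit_ball[of a p, OF weight_nonneg p(1), where ?'k = 'k]
    by blast
qed

end


section \<open>A set of indices of positive density with finite trace on every block\<close>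

definition block_entry :: "nat \<Rightarrow> nat \<Rightarrow> nat" where
  "block_entry s y = s * (s + 1) div 2 + y * s + y * (y - 1) div 2"

text \<open>
  The first \<open>s + 1\<close> entries of each block \<open>I\<^sub>s\<close>. The position grows with the block number at such a rate
  that only finitely many entries of a fixed block are taken, but a fixed proportion of all
  indices: arranging the indices in rows of lengths \<open>1, 2, 3, \<dots>\<close>, so that \<open>s\<close> is the place within a
  row, these are the indices in about the second half of each row.
\<close>

definition front :: "nat set" where
  "front = {block_entry s y |s y. 1 \<le> s \<and> y \<le> s}"

lemma block_of_block_entry:
  assumes "1 \<le> s"
  shows "block_of (block_entry s y) = s"
proof -
  have "s * (s + 1) div 2 \<ge> 1" using assms by (cases s) auto
  then have "1 \<le> block_entry s y" by (simp add: block_entry_def)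
  moreover have "block_entry s y \<in> index_block s" by (auto simp: block_entry_def index_block_def)
  ultimately show ?thesis
    unfolding block_of_def using ex1_index_block assms by (intro the1_equality) auto
qed

lemma block_entry_strict_mono: "1 \<le> s \<Longrightarrow> strict_mono (block_entry s)"
proof (rule strict_monoI_Suc)
  fix y assume "1 \<le> s"
  have "y * (y - 1) div 2 \<le> Suc y * (Suc y - 1) div 2"
    by (intro div_le_mono mult_le_mono) auto
  then show "block_entry s y < block_entry s (Suc y)" using \<open>1 \<le> s\<close> by (simp add: block_entry_def)
qed

lemma block_entry_pos: "1 \<le> s \<Longrightarrow> 1 \<le> block_entry s y"
  by (cases s) (auto simp: block_entry_def)

lemma double_block_entry: "2 * block_entry s y = s * (s + 1) + 2 * y * s + y * (y - 1)"
proof -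
  have "even (s * (s + 1))" "even (y * (y - 1))" by auto
  then show ?thesis by (simp add: block_entry_def distrib_left)
qed

text \<open>
  The map \<open>(s, y) \<mapsto> (2 s + y, y)\<close> injects all positions into \<open>front\<close>; this estimate says that it
  increases the index at most eightfold.
\<close>

lemma block_entry_shift_le:
  assumes "1 \<le> s"
  shows "block_entry (2 * s + y) y \<le> 8 * block_entry s y"
proof -
  obtain r where s: "s = Suc r" using assms by (cases s) auto
  have "2 * block_entry (2 * s + y) y \<le> 8 * (2 * block_entry s y)"
    unfolding double_block_entry s by (cases y) (simp_all add: algebra_simps)
  then show ?thesis by simp
qed

lemma block_entry_exhaust:
  assumes "1 \<le> n"
  obtains s y where "1 \<le> s" "n = block_entry s y"
proof -
  obtain s where "1 \<le> s" "n \<in> index_block s" using ex1_index_block[OF assms] by blast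
  then show ?thesis using that by (auto simp: index_block_def block_entry_def)
qed

lemma front_dense: "\<exists>F\<subseteq>front. finite F \<and> card F = N \<and> (\<forall>j\<in>F. 1 \<le> j \<and> j \<le> 8 * N)"
proof -
  have "\<forall>n\<in>{1..}. \<exists>s y. 1 \<le> s \<and> n = block_entry s y"
    by (metis atLeast_iff block_entry_exhaust)
  then obtain s y where sy: "\<And>n. 1 \<le> n \<Longrightarrow> 1 \<le> s n" "\<And>n. 1 \<le> n \<Longrightarrow> n = block_entry (s n) (y n)"
    by (metis atLeast_iff)
  define f where "f n = block_entry (2 * s n + y n) (y n)" for n
  have "inj_on f {1..N}"
  proof (rule inj_onI)
    fix m n assume mn: "m \<in> {1..N}" "n \<in> {1..N}" "f m = f n"
    have 1: "1 \<le> 2 * s m + y m" "1 \<le> 2 * s n + y n" using sy(1)[of m] sy(1)[of n] mn by auto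
    then have eq: "2 * s m + y m = 2 * s n + y n"
      using block_of_block_entry mn(3) unfolding f_def by metis
    then have "y m = y n"
      using mn(3) strict_mono_eq[OF block_entry_strict_mono[OF 1(1)]] unfolding f_def by metis
    then show "m = n" using eq sy(2)[of m] sy(2)[of n] mn by simp
  qed
  moreover have "f n \<in> front \<and> 1 \<le> f n \<and> f n \<le> 8 * N" if "n \<in> {1..N}" for n
  proof (intro conjI)
    have n: "1 \<le> n" "n \<le> N" using that by auto
    show "f n \<in> front" unfolding front_def f_def using sy(1)[OF n(1)] by force
    show "1 \<le> f n" unfolding f_def using sy(1)[OF n(1)] by (intro block_entry_pos) simp
    show "f n \<le> 8 * N"
      using block_entry_shift_le[OF sy(1)[OF n(1)], of "y n"] sy(2)[OF n(1)] n(2) unfolding f_def by simp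
  qed
  ultimately show ?thesis by (intro exI[of _ "f ` {1..N}"]) (auto simp: card_image)
qed

lemma finite_front_block_less: "finite {n \<in> front. block_of n < k}"
proof (rule finite_subset)
  show "{n \<in> front. block_of n < k} \<subseteq> (\<lambda>(s, y). block_entry s y) ` ({..k} \<times> {..k})"
  proof
    fix n assume "n \<in> {n \<in> front. block_of n < k}"
    then obtain s y where "1 \<le> s" "y \<le> s" "n = block_entry s y" "s < k"
      unfolding front_def using block_of_block_entry by auto
    then show "n \<in> (\<lambda>(s, y). block_entry s y) ` ({..k} \<times> {..k})" by (auto intro!: image_eqI[of _ _ "(s, y)"])
  qed
qed simp

section \<open>The two spaces\<close>

lemma stable_exponents_multiple:
  assumes pos: "\<And>n. 1 \<le> n \<Longrightarrow> 0 < \<alpha> n" and st: "stable_exponents \<alpha>"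
  obtains D where "D > 0" "\<And>n. 1 \<le> n \<Longrightarrow> \<alpha> (8 * n) \<le> D * \<alpha> n"
proof -
  obtain C where C: "\<And>n. 1 \<le> n \<Longrightarrow> \<alpha> (2 * n) / \<alpha> n \<le> C"
    using st unfolding stable_exponents_def bdd_above_def by auto
  have C_pos: "C > 0"
    using C[of 1] pos[of 1] pos[of 2] by (smt (verit) divide_pos_pos mult.right_neutral one_le_numeral order_refl)
  have double: "\<alpha> (2 * n) \<le> C * \<alpha> n" if "1 \<le> n" for n
    using C[OF that] pos[OF that] by (simp add: pos_divide_le_eq)
  show ?thesis
  proof (rule that[of "C * C * C"])
    fix n :: nat assume n: "1 \<le> n"
    have "\<alpha> (8 * n) \<le> C * \<alpha> (4 * n)" using double[of "4 * n"] n by simp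
    also have "\<dots> \<le> C * (C * \<alpha> (2 * n))" using double[of "2 * n"] n C_pos by (intro mult_left_mono) auto
    also have "\<dots> \<le> C * (C * (C * \<alpha> n))" using double[OF n] C_pos by (intro mult_left_mono) auto
    finally show "\<alpha> (8 * n) \<le> C * C * C * \<alpha> n" by (simp add: mult_ac)
  qed (use C_pos in simp)
qed

text \<open>
  For \<open>K_weight\<close> the \<open>k\<close>-th weight exceeds \<open>1\<close> only on blocks below \<open>k\<close>, of which \<open>front\<close> contains
  finitely many indices.
\<close>

lemma finite_type_weights_front:
  assumes pos: "\<And>n. 1 \<le> n \<Longrightarrow> 0 < \<alpha> n" and mono: "\<And>m n. 1 \<le> m \<Longrightarrow> m \<le> n \<Longrightarrow> \<alpha> m \<le> \<alpha> n"
    and D: "0 < D" "\<And>n. 1 \<le> n \<Longrightarrow> \<alpha> (8 * n) \<le> D * \<alpha> n"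
  shows "finite_type_weights (\<lambda>k n. exp (- \<alpha> n / real k)) \<alpha> front D"
    and "finite_type_weights (K_weight \<alpha>) \<alpha> front D"
proof -
  have dense: "\<exists>F\<subseteq>front. finite F \<and> card F = Suc n \<and> (\<forall>j\<in>F. 1 \<le> j \<and> \<alpha> j \<le> D * \<alpha> (Suc n))" for n
  proof -
    obtain F where F: "F \<subseteq> front" "finite F" "card F = Suc n" "\<And>j. j \<in> F \<Longrightarrow> 1 \<le> j \<and> j \<le> 8 * Suc n"
      using front_dense[of "Suc n"] by metis
    have "\<alpha> j \<le> D * \<alpha> (Suc n)" if "j \<in> F" for j
      using mono[of j "8 * Suc n"] F(4)[OF that] D(2)[of "Suc n"] by simp
    then show ?thesis using F by blast
  qed
  have front_pos: "1 \<le> j" if "j \<in> front" for j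
    using that block_entry_pos unfolding front_def by auto
  show "finite_type_weights (\<lambda>k n. exp (- \<alpha> n / real k)) \<alpha> front D"
  proof
    fix p q n :: nat assume "1 \<le> p" "p < q"
    show "exp (- \<alpha> n / real p) \<le> exp (- ((1 / real p - 1 / real q) * \<alpha> n)) * exp (- \<alpha> n / real q)"
      by (simp flip: exp_add add: algebra_simps)
  next
    fix k :: nat assume "1 \<le> k"
    show "\<exists>C. \<forall>j\<in>front. exp (- \<alpha> j / real k) \<le> C"
    proof (intro exI ballI)
      fix j assume "j \<in> front"
      then show "exp (- \<alpha> j / real k) \<le> 1" using pos[OF front_pos, of j] by (simp add: less_imp_le)
    qed
  qed (use pos mono D(1) dense in auto)
  show "finite_type_weights (K_weight \<alpha>) \<alpha> front D"
  proof
    fix p q n :: nat assume pq: "1 \<le> p" "p < q" and n: "1 \<le> n"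
    show "K_weight \<alpha> p n \<le> exp (- ((1 / real p - 1 / real q) * \<alpha> n)) * K_weight \<alpha> q n"
      using pos[OF n] pq by (auto simp: K_weight_def algebra_simps simp flip: exp_add)
  next
    fix p n :: nat assume "1 \<le> p" "1 \<le> n"
    then show "exp (- (\<alpha> n / real p)) \<le> K_weight \<alpha> p n"
      using pos[of n] by (auto simp: K_weight_def algebra_simps)
  next
    fix k :: nat assume "1 \<le> k"
    \<comment> \<open>The weights exceeding \<open>1\<close> are among finitely many; their sum is a convenient bound.\<close>
    let ?A = "{n \<in> front. block_of n < k}"
    show "\<exists>C. \<forall>j\<in>front. K_weight \<alpha> k j \<le> C"
    proof (intro exI ballI)
      fix j assume j: "j \<in> front"
      have nonneg: "0 \<le> K_weight \<alpha> k i" for i by (simp add: K_weight_def)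
      show "K_weight \<alpha> k j \<le> 1 + (\<Sum>i\<in>?A. K_weight \<alpha> k i)"
      proof (cases "block_of j < k")
        case True
        then show ?thesis
          using member_le_sum[of j ?A "K_weight \<alpha> k"] j nonneg finite_front_block_less[of k] by auto
      next
        case False
        then have "K_weight \<alpha> k j \<le> 1"
          using pos[OF front_pos[OF j]] by (simp add: K_weight_def less_imp_le)
        then show ?thesis using sum_nonneg[of ?A "K_weight \<alpha> k"] nonneg by simp
      qed
    qed
  qed (use pos mono D(1) dense in \<open>auto simp: K_weight_def\<close>)
qed

theorem corollary3p5:
  fixes \<alpha> :: "nat \<Rightarrow> real"
  assumes "strict_mono_on {1..} \<alpha>"
    and "\<And>n. n \<ge> 1 \<Longrightarrow> \<alpha> n > 0"
    and "filterlim \<alpha> at_top sequentially"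
    and "finitely_nuclear TYPE('k::real_normed_field) \<alpha>"
    and "stable_exponents \<alpha>"
  shows "seq.diametral_dimension (K_space \<alpha> :: (nat \<Rightarrow> 'k) graded_space)
           = seq.diametral_dimension (power_series_space \<alpha>)
         \<and> seq.approximate_diametral_dimension (K_space \<alpha> :: (nat \<Rightarrow> 'k) graded_space)
           = seq.approximate_diametral_dimension (power_series_space \<alpha>)"
proof -
  have mono: "\<alpha> m \<le> \<alpha> n" if "1 \<le> m" "m \<le> n" for m n
    using strict_mono_onD[OF assms(1), of m n] that by (cases "m = n") auto
  obtain D where D: "D > 0" "\<And>n. 1 \<le> n \<Longrightarrow> \<alpha> (8 * n) \<le> D * \<alpha> n"
    using stable_exponents_multiple[OF assms(2,5)] by blast
  have w1: "finite_type_weights (\<lambda>k n. exp (- \<alpha> n / real k)) \<alpha> front D"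
    and w2: "finite_type_weights (K_weight \<alpha>) \<alpha> front D"
    by (rule finite_type_weights_front[of \<alpha>, OF assms(2) mono D]; assumption)+
  interpret L: finite_type_weights "\<lambda>k n. exp (- \<alpha> n / real k)" \<alpha> front D by (rule w1)
  interpret K: finite_type_weights "K_weight \<alpha>" \<alpha> front D by (rule w2)
  show ?thesis
    unfolding K_space_def power_series_space_def
    unfolding L.diametral_dimension_eq K.diametral_dimension_eq
      L.approximate_diametral_dimension_eq K.approximate_diametral_dimension_eq by blast
qed

end
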